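(* Let $\varphi = \frac{1+\sqrt5}{2}$ and let $F = F_0F_1F_2\cdots$ be the infinite Fibonacci word over $\{0,1\}$. Then the densities $\delta_0(F)$ and $\delta_1(F)$ of the symbols $0$ and $1$ in $F$ exist (as limits) and are given by \[ \delta_0(F) = \frac{1}{\varphi}, \qquad \delta_1(F) = \frac{1}{\varphi^2}. \] In particular, the frequency of $1$'s in $F$ is strictly less than the frequency of $0$'s, and \[ \frac{\delta_1(F)}{\delta_0(F)} = \frac{1}{\varphi}. \]
   Context: Let $\varphi = \frac{1+\sqrt5}{2}$, so $\varphi^2=\varphi+1$. The infinite Fibonacci word $F = (F_k)_{k\ge 0}$ over $\{0,1\}$ is defined by: $F_k = 0$ if $k+1 = \lfloor n\varphi\rfloor$ for some integer $n\ge 1$, and $F_k = 1$ if $k+1 = \lfloor n\varphi^2\rfloor$ for some integer $n\ge 1$ (by Beatty's theorem exactly one of the two cases occurs for each $k \ge 0$). Equivalently, $F = \lim_{n\to\infty}\sigma^n(0) = 0100101001001\cdots$, where $\sigma$ is the morphism of $\{0,1\}^*$ with $\sigma(0)=01$, $\sigma(1)=0$. For $n\ge 1$ let $F[0..n-1] = F_0F_1\cdots F_{n-1}$, $|F[0..n-1]|_1 = \#\{0\le k<n : F_k = 1\}$ and $|F[0..n-1]|_0 = n - |F[0..n-1]|_1$. The densities are $\delta_i(F) = \lim_{n\to\infty} \frac{|F[0..n-1]|_i}{n}$ for $i\in\{0,1\}$, provided the limits exist. *)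

theory Defs
  imports Complex_Main
begin

definition golden :: real ("\<phi>")
  where "\<phi> = (1 + sqrt 5) / 2"

text \<open>
  By Beatty's theorem, the indices that are not of the form \<open>\<lfloor>n \<phi>\<rfloor> - 1\<close> are exactly those of
  the form \<open>\<lfloor>n \<phi>\<^sup>2\<rfloor> - 1\<close>; hence the default value \<open>1\<close>. The two facts
  \<open>fib_word_eq_0_iff\<close> and \<open>fib_word_eq_1_iff\<close> below give the symmetric description.
\<close>

definition fib_word :: "nat \<Rightarrow> nat"
  where "fib_word k = (if \<exists>n::nat. n \<ge> 1 \<and> int (k + 1) = \<lfloor>real n * \<phi>\<rfloor> then 0 else 1)"

definition prefix_count :: "(nat \<Rightarrow> 'a) \<Rightarrow> 'a \<Rightarrow> nat \<Rightarrow> nat"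
  where "prefix_count w a n = card {k. k < n \<and> w k = a}"

definition prefix_freq :: "(nat \<Rightarrow> 'a) \<Rightarrow> 'a \<Rightarrow> nat \<Rightarrow> real"
  where "prefix_freq w a n = real (prefix_count w a n) / real n"

text \<open>Only meaningful if \<open>prefix_freq w a\<close> is convergent.\<close>

definition density :: "(nat \<Rightarrow> 'a) \<Rightarrow> 'a \<Rightarrow> real"
  where "density w a = lim (prefix_freq w a)"

lemma fib_word_eq_0_iff:
  "fib_word k = 0 \<longleftrightarrow> (\<exists>n::nat. n \<ge> 1 \<and> int (k + 1) = \<lfloor>real n * \<phi>\<rfloor>)"
  by (simp add: fib_word_def)

lemma golden_gt_1: "\<phi> > 1"
  unfolding golden_def using real_less_rsqrt[of 1 5] by simp

lemma golden_sq: "\<phi>\<^sup>2 = \<phi> + 1"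
  by (simp add: golden_def power2_eq_square field_simps)

lemma golden_irrational: "\<phi> \<notin> \<rat>"
proof
  assume "\<phi> \<in> \<rat>"
  then obtain m n :: nat where n: "n \<noteq> 0" and mn: "\<bar>\<phi>\<bar> = real m / real n" and co: "coprime m n"
    by (rule Rats_abs_nat_div_natE)
  from mn n golden_gt_1 have "real m = \<phi> * real n" by (simp add: field_simps)
  then have "(real m)\<^sup>2 = real m * real n + (real n)\<^sup>2"
    using golden_sq by (simp add: power_mult_distrib) (simp add: power2_eq_square algebra_simps)
  then have "real (m\<^sup>2) = real (m * n + n\<^sup>2)" by simp
  then have eq: "m\<^sup>2 = m * n + n\<^sup>2" by (simp only: of_nat_eq_iff)
  then have "n dvd m\<^sup>2" by (simp add: power2_eq_square)
  with co have "n = 1"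
    by (metis coprime_common_divisor_nat coprime_power_left_iff dvd_refl zero_less_numeral)
  with eq have "m * m = m + 1" by (simp add: power2_eq_square)
  then have "m * (m - 1) = 1" by (simp add: right_diff_distrib')
  then show False by (auto simp: nat_mult_eq_1_iff)
qed

lemma floor_mult_eq_iff:
  fixes x :: real and n m :: nat
  assumes "x > 0"
  shows "int m = \<lfloor>real n * x\<rfloor> \<longleftrightarrow> real m / x \<le> real n \<and> real n < (real m + 1) / x"
  using assms by (auto simp: eq_commute[of "int m"] floor_eq_iff field_simps)

lemma fib_word_eq_1_iff:
  "fib_word k = 1 \<longleftrightarrow> (\<exists>n::nat. n \<ge> 1 \<and> int (k + 1) = \<lfloor>real n * \<phi>\<^sup>2\<rfloor>)"
proof -
  define m where "m = k + 1"
  define a where "a = 1 / \<phi>"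
  have m: "m \<ge> 1" by (simp add: m_def)
  have pos: "\<phi> > 0" "\<phi>\<^sup>2 > 0" using golden_gt_1 by simp_all
  have a: "a > 0" "a < 1" using golden_gt_1 by (auto simp: a_def)
  have b: "1 / \<phi>\<^sup>2 = 1 - a"
    using golden_sq pos by (simp add: a_def power2_eq_square field_simps)
  have irr: "real j * a \<noteq> real_of_int i" if "j > 0" for j i
  proof
    assume eq: "real j * a = real_of_int i"
    with that a have "real_of_int i \<noteq> 0" by (metis less_numeral_extra(3) mult_pos_pos of_nat_0_less_iff)
    with eq pos have "\<phi> = real j / real_of_int i" by (simp add: a_def field_simps)
    then have "\<phi> \<in> \<rat>" by (metis Rats_divide Rats_of_int Rats_of_nat)
    then show False using golden_irrational by contradiction
  qed
  have f1: "int m = \<lfloor>real n * \<phi>\<rfloor> \<longleftrightarrow> real m * a \<le> real n \<and> real n < (real m + 1) * a" for n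
    using floor_mult_eq_iff[OF pos(1), of m n] by (simp add: a_def)
  have f2: "int m = \<lfloor>real n * \<phi>\<^sup>2\<rfloor> \<longleftrightarrow>
      real m * (1 - a) \<le> real n \<and> real n < (real m + 1) * (1 - a)" for n
    using floor_mult_eq_iff[OF pos(2), of m n] by (simp flip: b)
  have disj: False if "int m = \<lfloor>real n * \<phi>\<rfloor>" "int m = \<lfloor>real n' * \<phi>\<^sup>2\<rfloor>" for n n'
  proof -
    have "real m * a \<noteq> real n" using irr[of m "int n"] m by simp
    with that have "real m < real n + real n'" "real n + real n' < real m + 1"
      unfolding f1 f2 by (auto simp: algebra_simps)
    then have "real m < real (n + n')" "real (n + n') < real (m + 1)" by simp_all
    then show False unfolding of_nat_less_iff by linarith
  qed
  define N where "N = \<lfloor>(real m + 1) * a\<rfloor>"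
  have N: "real_of_int N < (real m + 1) * a" "real_of_int N > (real m + 1) * a - 1"
    using irr[of "m + 1" N] unfolding N_def by (auto simp: algebra_simps) linarith+
  have cover: "(\<exists>n::nat. n \<ge> 1 \<and> int m = \<lfloor>real n * \<phi>\<rfloor>) \<or> (\<exists>n::nat. n \<ge> 1 \<and> int m = \<lfloor>real n * \<phi>\<^sup>2\<rfloor>)"
  proof (cases "real_of_int N > real m * a")
    case True
    moreover have "real m * a > 0" using m a by simp
    ultimately have "real_of_int N > 0" by linarith
    then have "nat N \<ge> 1" "real (nat N) = real_of_int N" by simp_all
    moreover from this True N have "int m = \<lfloor>real (nat N) * \<phi>\<rfloor>" unfolding f1 by simp
    ultimately show ?thesis by blast
  next
    case False
    then have lt: "real_of_int N < real m * a" using irr[of m N] m by simp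
    have "real m * (1 - a) > 0" using m a by simp
    then have "real_of_int (int m - N) > 0" using lt by (simp add: algebra_simps)
    then have "nat (int m - N) \<ge> 1" "real (nat (int m - N)) = real m - real_of_int N"
      by simp_all
    moreover from this lt N have "int m = \<lfloor>real (nat (int m - N)) * \<phi>\<^sup>2\<rfloor>"
      unfolding f2 by (simp add: algebra_simps)
    ultimately show ?thesis by blast
  qed
  have "fib_word k = 1 \<longleftrightarrow> \<not> (\<exists>n::nat. n \<ge> 1 \<and> int m = \<lfloor>real n * \<phi>\<rfloor>)"
    by (simp add: fib_word_def m_def)
  then show ?thesis using disj cover unfolding m_def[symmetric] by blast
qed

text \<open>The letters \<open>0\<close> and \<open>1\<close> exhaust the alphabet of \<open>fib_word\<close>.\<close>

lemma prefix_count_fib_word_0: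
  "prefix_count fib_word 0 n = n - prefix_count fib_word 1 n"
proof -
  have "{k. k < n \<and> fib_word k = 0} = {..<n} - {k. k < n \<and> fib_word k = 1}"
    by (auto simp: fib_word_def)
  moreover have "{k. k < n \<and> fib_word k = 1} \<subseteq> {..<n}" by auto
  ultimately show ?thesis
    unfolding prefix_count_def by (simp add: card_Diff_subset finite_subset)
qed

end

theory Submission
  imports Defs
begin

text \<open>
  The zeros of the Fibonacci word sit at the positions \<open>\<lfloor>j \<phi>\<rfloor> - 1\<close>, that is, along the
  Beatty sequence of \<open>\<phi>\<close>. For any slope \<open>x \<ge> 1\<close> the Beatty sequence \<open>\<lfloor>j x\<rfloor>\<close> is injective, and
  \<open>\<lfloor>j x\<rfloor> \<le> n\<close> holds precisely when \<open>j < (n + 1) / x\<close>; so it has \<open>n / x + O(1)\<close> members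
  up to \<open>n\<close> (\<open>card_beatty_upto\<close>) and density \<open>1 / x\<close>. With \<open>x = \<phi>\<close> this is the density of the
  letter \<open>0\<close>. Every other letter is a \<open>1\<close>, whence the density \<open>1 - 1 / \<phi>\<close> of the letter \<open>1\<close>, and
  \<open>1 - 1 / \<phi> = 1 / \<phi>\<^sup>2\<close> because \<open>\<phi>\<^sup>2 = \<phi> + 1\<close>.
\<close>

text \<open>
  Steps of length at least \<open>1\<close> strictly increase the floor, so counting the values of the Beatty
  sequence up to \<open>n\<close> amounts to counting the indices \<open>j \<ge> 1\<close> with \<open>j x < n + 1\<close>.
\<close>

lemma card_beatty_upto:
  fixes x :: real
  assumes x: "x \<ge> 1"
  shows "card {k. k < n \<and> (\<exists>j::nat. j \<ge> 1 \<and> int (k + 1) = \<lfloor>real j * x\<rfloor>)}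
           = nat \<lceil>real (n + 1) / x\<rceil> - 1"
proof -
  define J :: "nat set" where "J = {1..<nat \<lceil>real (n + 1) / x\<rceil>}"
  define g where "g j = nat \<lfloor>real j * x\<rfloor> - 1" for j
  have J_iff: "j \<in> J \<longleftrightarrow> j \<ge> 1 \<and> real j * x < real n + 1" for j
  proof -
    have "j < nat \<lceil>real (n + 1) / x\<rceil> \<longleftrightarrow> real j < real (n + 1) / x"
      by (simp add: zless_nat_eq_int_zless less_ceiling_iff)
    also have "\<dots> \<longleftrightarrow> real j * x < real n + 1"
      using x by (simp add: field_simps)
    finally show ?thesis by (simp add: J_def)
  qed
  have g: "int (g j + 1) = \<lfloor>real j * x\<rfloor>" if "j \<ge> 1" for j
  proof -
    have "1 * 1 \<le> real j * x" using that x by (intro mult_mono) auto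
    then have "1 \<le> \<lfloor>real j * x\<rfloor>" by simp
    then show ?thesis by (simp add: g_def)
  qed
  have mono: "\<lfloor>real i * x\<rfloor> < \<lfloor>real j * x\<rfloor>" if "i < j" for i j
  proof -
    have "(real i + 1) * x \<le> real j * x" using that x by (intro mult_right_mono) auto
    then have "real i * x + 1 \<le> real j * x" using x by (simp add: algebra_simps)
    then show ?thesis by linarith
  qed
  have "inj_on g J"
  proof (rule inj_onI)
    fix i j assume "i \<in> J" "j \<in> J" "g i = g j"
    then have "\<lfloor>real i * x\<rfloor> = \<lfloor>real j * x\<rfloor>"
      using g[of i] g[of j] by (simp add: J_iff)
    then show "i = j"
      using mono[of i j] mono[of j i] by (cases i j rule: linorder_cases) auto
  qed
  moreover have "{k. k < n \<and> (\<exists>j::nat. j \<ge> 1 \<and> int (k + 1) = \<lfloor>real j * x\<rfloor>)} = g ` J"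
  proof (intro equalityI subsetI)
    fix k assume "k \<in> {k. k < n \<and> (\<exists>j::nat. j \<ge> 1 \<and> int (k + 1) = \<lfloor>real j * x\<rfloor>)}"
    then obtain j where j: "k < n" "j \<ge> 1" "int (k + 1) = \<lfloor>real j * x\<rfloor>" by blast
    then have "real j * x < real n + 1" by linarith
    moreover have "k = g j" using g[OF j(2)] j(3) by linarith
    ultimately show "k \<in> g ` J" using j(2) J_iff by blast
  next
    fix k assume "k \<in> g ` J"
    then obtain j where j: "k = g j" "j \<ge> 1" "real j * x < real n + 1" by (auto simp: J_iff)
    then have "k < n" using g[OF j(2)] by linarith
    then show "k \<in> {k. k < n \<and> (\<exists>j::nat. j \<ge> 1 \<and> int (k + 1) = \<lfloor>real j * x\<rfloor>)}"
      using g[OF j(2)] j by blast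
  qed
  ultimately show ?thesis by (simp add: card_image J_def)
qed

text \<open>
  The number of zeros differs from \<open>(n + 1) / \<phi>\<close> by a rounding downwards of at most \<open>1\<close>, and
  \<open>(n + 1) / \<phi>\<close> exceeds \<open>n / \<phi>\<close> by less than \<open>1\<close>. These two deviations have opposite signs, so
  after division by \<open>n\<close> the total error is at most \<open>1 / n\<close>.
\<close>

lemma prefix_freq_fib_word_0_tendsto: "prefix_freq fib_word 0 \<longlonglongrightarrow> 1 / \<phi>"
proof -
  have bound: "\<bar>real (prefix_count fib_word 0 n) - real n / \<phi>\<bar> \<le> 1" for n
  proof -
    have count: "prefix_count fib_word 0 n = nat \<lceil>real (n + 1) / \<phi>\<rceil> - 1"
      unfolding prefix_count_def fib_word_eq_0_iff
      using golden_gt_1 by (intro card_beatty_upto) simp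
    have "real (n + 1) / \<phi> > 0" using golden_gt_1 by simp
    then have "\<lceil>real (n + 1) / \<phi>\<rceil> \<ge> 1" by linarith
    then have "real (prefix_count fib_word 0 n) = of_int \<lceil>real (n + 1) / \<phi>\<rceil> - 1"
      unfolding count by linarith
    moreover have "real (n + 1) / \<phi> = real n / \<phi> + 1 / \<phi>" by (simp add: add_divide_distrib)
    moreover have "0 < 1 / \<phi>" "1 / \<phi> < 1" using golden_gt_1 by simp_all
    ultimately show ?thesis by linarith
  qed
  have "(\<lambda>n. prefix_freq fib_word 0 n - 1 / \<phi>) \<longlonglongrightarrow> 0"
  proof (rule tendsto_0_le)
    show "(\<lambda>n. 1 / real n) \<longlonglongrightarrow> 0" by (rule lim_1_over_n)
    show "\<forall>\<^sub>F n in sequentially. norm (prefix_freq fib_word 0 n - 1 / \<phi>) \<le> norm (1 / real n) * 1"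
    proof (rule eventually_sequentiallyI)
      fix n :: nat assume n: "1 \<le> n"
      have "prefix_freq fib_word 0 n - 1 / \<phi>
          = (real (prefix_count fib_word 0 n) - real n / \<phi>) / real n"
        using n by (simp add: prefix_freq_def diff_divide_distrib)
      then show "norm (prefix_freq fib_word 0 n - 1 / \<phi>) \<le> norm (1 / real n) * 1"
        using bound[of n] n by (simp add: divide_right_mono)
    qed
  qed
  then show ?thesis by (simp add: LIM_zero_iff)
qed

lemma prefix_freq_fib_word_1:
  assumes "n > 0"
  shows "prefix_freq fib_word 1 n = 1 - prefix_freq fib_word 0 n"
proof -
  have "prefix_count fib_word 1 n \<le> card {..<n}"
    unfolding prefix_count_def by (intro card_mono) auto
  then show ?thesis
    using assms by (simp add: prefix_freq_def prefix_count_fib_word_0 of_nat_diff diff_divide_distrib)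
qed

lemma prefix_freq_fib_word_1_tendsto: "prefix_freq fib_word 1 \<longlonglongrightarrow> 1 / \<phi>\<^sup>2"
proof -
  have "(\<lambda>n. 1 - prefix_freq fib_word 0 n) \<longlonglongrightarrow> 1 - 1 / \<phi>"
    by (intro tendsto_intros prefix_freq_fib_word_0_tendsto)
  moreover have "\<forall>\<^sub>F n in sequentially. 1 - prefix_freq fib_word 0 n = prefix_freq fib_word 1 n"
    using eventually_gt_at_top[of 0] by eventually_elim (simp only: prefix_freq_fib_word_1)
  moreover have "1 - 1 / \<phi> = 1 / \<phi>\<^sup>2"
    using golden_sq golden_gt_1 by (simp add: power2_eq_square field_simps)
  ultimately show ?thesis by (metis Lim_transform_eventually)
qed

theorem theorem3p2:
  shows "convergent (prefix_freq fib_word 0) \<and> convergent (prefix_freq fib_word 1)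
    \<and> density fib_word 0 = 1 / \<phi> \<and> density fib_word 1 = 1 / \<phi>\<^sup>2
    \<and> density fib_word 1 < density fib_word 0
    \<and> density fib_word 1 / density fib_word 0 = 1 / \<phi>"
proof -
  have d: "density fib_word 0 = 1 / \<phi>" "density fib_word 1 = 1 / \<phi>\<^sup>2"
    unfolding density_def
    using prefix_freq_fib_word_0_tendsto prefix_freq_fib_word_1_tendsto by (simp_all add: limI)
  have "1 / \<phi>\<^sup>2 < 1 / \<phi>" "1 / \<phi>\<^sup>2 / (1 / \<phi>) = 1 / \<phi>"
    using golden_gt_1 by (simp_all add: power2_eq_square field_simps)
  then show ?thesis
    using d prefix_freq_fib_word_0_tendsto prefix_freq_fib_word_1_tendsto
    by (auto intro: convergentI)
qed

end
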